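(* For every $p\in\mathbb Z$ and $n\ge0$, the coefficients $c_{n,p}$ in the expansion $\omega^p=\sum_{n=0}^\infty c_{n,p}R_n$ are given by $$c_{n,p}=\frac{1}{(a-a^{-1})^{2n}}\sum_{k=0}^n\frac{(-1)^k\mu_{2k}^p\,[2k+1]}{[n+k+1]!\,[n-k]!}.$$
   Context: $A$ is an indeterminate, $a=A^2$, $\{n\}=a^n-a^{-n}$, $[n]=\{n\}/\{1\}$, $[n]!=[1][2]\cdots[n]$ (with $[0]!=1$). $\mathcal B=\mathbb Z[A^{\pm1}][z]$ (the Kauffman bracket skein module of the solid torus, with $z$ the core); $\mathcal B^{ev}$ is the submodule generated by the even powers of $z$. The basis $\{e_i\}_{i\ge0}$ of $\mathcal B$ is defined by $e_0=1$, $e_1=z$, $e_i=ze_{i-1}-e_{i-2}$. The twist map $t:\mathcal B\to\mathcal B$ is the $\mathbb Z[A^{\pm1}]$-linear map with $t(e_i)=\mu_ie_i$, $\mu_i=(-1)^iA^{i^2+2i}$. The symmetric bilinear form $\langle\ ,\ \rangle$ on $\mathcal B$ (cabling the zero-framed Hopf link and taking the Kauffman bracket) is determined by $\langle f(z),e_i\rangle=f(\lambda_i)\langle e_i\rangle$ for all $f(z)\in\mathcal B$, where $\lambda_i=-a^{i+1}-a^{-i-1}$ and $\langle e_i\rangle=(-1)^i[i+1]$. One writes $\langle x\rangle=\langle x,1\rangle$. $R_n=\prod_{i=0}^{n-1}(z-\lambda_{2i})$ (with $R_0=1$). One has $\langle R_n,z^{2k}\rangle=0$ for $k<n$, so formal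 series $\sum_{n\ge0}c_nR_n$ with $c_n\in\mathbb Q(A)$ pair with elements of $\mathcal B^{ev}$ by finite sums. Such series can be multiplied: since $R_n$ divides $R_{n+1}$, in the expansion $R_nR_m=\sum_kC^k_{n,m}R_k$ the coefficient $C_{n,m}^k$ vanishes if $n$ or $m$ exceeds $k$. The series $\omega=\omega_+$ is the unique such series with $\langle\omega,x\rangle=\langle t(x)\rangle$ for every $x\in\mathcal B^{ev}$. It is invertible, and $\omega^p$ denotes its $p$-th power in this ring; equivalently, $\omega^p$ is the unique series with $\langle\omega^p,x\rangle=\langle t^p(x)\rangle$ for every $x\in\mathcal B^{ev}$. *)

theory Defs
  imports
    "HOL-Library.Poly_Mapping"
    "HOL-Library.Groups_Big_Fun"
    "HOL-Computational_Algebra.Polynomial_Factorial"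
    "HOL-Algebra.Ring"
begin

text \<open>The Laurent polynomial ring \<open>\<int>[A\<^sup>\<plusminus>\<^sup>1]\<close> is the group ring of the infinite cyclic group:
  an element is a finitely supported family of integer coefficients indexed by the exponents of
  \<open>A\<close>, multiplied by convolution. Its field of fractions is \<open>\<rat>(A)\<close>.\<close>

type_synonym laurent = "int \<Rightarrow>\<^sub>0 int"
type_synonym ratfun = "laurent fract"

text \<open>The skein module of the solid torus; the polynomial variable is the core \<open>z\<close>.\<close>

type_synonym skein = "laurent poly"

definition A_pow :: "int \<Rightarrow> laurent" where
  "A_pow k = Poly_Mapping.single k 1"

definition a_pow :: "int \<Rightarrow> laurent" where
  "a_pow k = A_pow (2 * k)"

definition qbrace :: "int \<Rightarrow> laurent" where
  "qbrace n = a_pow n - a_pow (- n)"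

definition qint :: "int \<Rightarrow> ratfun" where
  "qint n = to_fract (qbrace n) / to_fract (qbrace 1)"

definition qfact :: "nat \<Rightarrow> ratfun" where
  "qfact n = (\<Prod>i=1..n. qint (int i))"

fun e_basis :: "nat \<Rightarrow> skein" where
  "e_basis 0 = 1"
| "e_basis (Suc 0) = [:0, 1:]"
| "e_basis (Suc (Suc i)) = [:0, 1:] * e_basis (Suc i) - e_basis i"

definition skein_even :: "skein set" where
  "skein_even = module.span smult (range (\<lambda>k. [:0, 1:] ^ (2 * k)))"

definition twist_eigenvalue :: "nat \<Rightarrow> laurent" where
  "twist_eigenvalue i = (- 1) ^ i * A_pow (int (i\<^sup>2 + 2 * i))"

definition twist :: "skein \<Rightarrow> skein" where
  "twist = (THE t. module_hom smult smult t \<and>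
     (\<forall>i. t (e_basis i) = smult (twist_eigenvalue i) (e_basis i)))"

definition lam :: "nat \<Rightarrow> laurent" where
  "lam i = - a_pow (int i + 1) - a_pow (- int i - 1)"

definition bracket_e :: "nat \<Rightarrow> ratfun" where
  "bracket_e i = (- 1) ^ i * qint (int i + 1)"

definition hopf_form :: "skein \<Rightarrow> skein \<Rightarrow> laurent" where
  "hopf_form = (THE B.
     (\<forall>f. module_hom smult (*) (B f)) \<and>
     (\<forall>g. module_hom smult (*) (\<lambda>f. B f g)) \<and>
     (\<forall>f g. B f g = B g f) \<and>
     (\<forall>f i. to_fract (B f (e_basis i)) = to_fract (poly f (lam i)) * bracket_e i))"

definition skein_bracket :: "skein \<Rightarrow> laurent" where
  "skein_bracket x = hopf_form x 1"

definition R_poly :: "nat \<Rightarrow> skein" where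
  "R_poly n = (\<Prod>i<n. [:0, 1:] - [:lam (2 * i):])"

text \<open>A formal series \<open>\<Sum>n. c n R_poly n\<close> is represented by its coefficient function \<open>c\<close>.\<close>

type_synonym R_series = "nat \<Rightarrow> ratfun"

text \<open>Only meant for \<open>x \<in> skein_even\<close>, for which the sum has finite support.\<close>

definition series_pairing :: "R_series \<Rightarrow> skein \<Rightarrow> ratfun" where
  "series_pairing c x = Sum_any (\<lambda>n. c n * to_fract (hopf_form (R_poly n) x))"

definition R_structure_const :: "nat \<Rightarrow> nat \<Rightarrow> nat \<Rightarrow> laurent" where
  "R_structure_const n m k = module.representation smult (range R_poly) (R_poly n * R_poly m) (R_poly k)"

text \<open>In the product, the coefficient of \<open>R_poly k\<close> only involves indices \<open>n, m \<le> k\<close>, since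
  \<open>R_structure_const n m k\<close> vanishes for all others.\<close>

definition series_ring :: "R_series ring" where
  "series_ring = \<lparr>carrier = UNIV,
     mult = (\<lambda>c d k. \<Sum>n\<le>k. \<Sum>m\<le>k. c n * d m * to_fract (R_structure_const n m k)),
     one = (\<lambda>n. if n = 0 then 1 else 0),
     zero = (\<lambda>n. 0),
     add = (\<lambda>c d n. c n + d n)\<rparr>"

definition omega :: "R_series" where
  "omega = (THE c. \<forall>x\<in>skein_even. series_pairing c x = to_fract (skein_bracket (twist x)))"

end

theory Submission
  imports Defs
begin

text \<open>Evaluation of a series at the nodes \<open>z = \<lambda>\<^sub>2\<^sub>k\<close> is a finite sum because \<open>R\<^sub>n\<close> vanishes there for
  \<open>n > k\<close>, and it identifies the ring of series with the ring of all functions on the nodes.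
  Since \<open>\<langle>R\<^sub>n, e\<^sub>2\<^sub>k\<rangle> = R\<^sub>n(\<lambda>\<^sub>2\<^sub>k)\<langle>e\<^sub>2\<^sub>k\<rangle>\<close>, the series \<open>\<omega>\<close> is the one with values \<open>\<mu>\<^sub>2\<^sub>k\<close>, so \<open>\<omega>\<^sup>p\<close>
  has values \<open>\<mu>\<^sub>2\<^sub>k\<^sup>p\<close>. The \<open>R\<^sub>n\<close> form the Newton basis of the nodes, hence the coefficients are the divided
  differences \<open>\<Sum>\<^sub>k\<^sub>\<le>\<^sub>n \<mu>\<^sub>2\<^sub>k\<^sup>p / \<Prod>\<^sub>i\<^sub>\<noteq>\<^sub>k (\<lambda>\<^sub>2\<^sub>k - \<lambda>\<^sub>2\<^sub>i)\<close>, and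
  \<open>\<lambda>\<^sub>2\<^sub>k - \<lambda>\<^sub>2\<^sub>i = - {k - i} {k + i + 1}\<close> turns the denominators into quantum factorials.\<close>

section \<open>Newton interpolation\<close>

text \<open>The divided difference \<open>f[x 0, ..., x n]\<close> in its symmetric closed
  form.\<close>

definition newton_coeff :: "(nat \<Rightarrow> 'a::field) \<Rightarrow> (nat \<Rightarrow> 'a) \<Rightarrow> nat \<Rightarrow> 'a" where
  "newton_coeff x f n = (\<Sum>j\<le>n. f j / (\<Prod>i\<in>{..n} - {j}. x j - x i))"

text \<open>The right side is the \<open>j\<close>-th Lagrange basis polynomial for the nodes
  \<open>x 0, ..., x N\<close>, the left side its Newton expansion. Adding a node rests on
  \<open>(x j - x (Suc N)) + (y - x j) = y - x (Suc N)\<close>.\<close>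

lemma newton_telescope:
  fixes x :: "nat \<Rightarrow> 'a::field"
  assumes "inj x" "j \<le> N"
  shows "(\<Sum>n=j..N. (\<Prod>i<n. y - x i) / (\<Prod>i\<in>{..n} - {j}. x j - x i)) =
    (\<Prod>i\<in>{..N} - {j}. y - x i) / (\<Prod>i\<in>{..N} - {j}. x j - x i)"
  using assms(2)
proof (induction N rule: dec_induct)
  case base
  have "{..j} - {j} = {..<j}" by auto
  then show ?case by simp
next
  case (step N)
  let ?Q = "\<lambda>y. \<Prod>i\<in>{..N} - {j}. y - x i"
  have set: "{..Suc N} - {j} = insert (Suc N) ({..N} - {j})"
    using step.hyps by auto
  have below: "(\<Prod>i<Suc N. y - x i) = (y - x j) * ?Q y"
    unfolding lessThan_Suc_atMost using step.hyps by (subst prod.remove[of _ j]) auto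
  have nz: "?Q (x j) \<noteq> 0" "x j - x (Suc N) \<noteq> 0"
    using assms(1) step.hyps by (auto simp: inj_eq)
  have split: "(\<Prod>i\<in>{..Suc N} - {j}. z - x i) = (z - x (Suc N)) * ?Q z" for z
    unfolding set by (subst prod.insert) auto
  have "(\<Sum>n=j..Suc N. (\<Prod>i<n. y - x i) / (\<Prod>i\<in>{..n} - {j}. x j - x i)) =
      ?Q y / ?Q (x j) + (y - x j) * ?Q y / ((x j - x (Suc N)) * ?Q (x j))"
    using step.hyps by (simp only: sum.atLeast_Suc_atMost_Suc_shift sum.nat_ivl_Suc' below split step.IH) simp
  also have "\<dots> = (y - x (Suc N)) * ?Q y / ((x j - x (Suc N)) * ?Q (x j))"
    using nz by (simp add: divide_simps) (simp add: algebra_simps)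
  finally show ?case unfolding split .
qed

text \<open>Swapping the two sums and telescoping turns the Newton form into the Lagrange form,
  whose value at a node is immediate.\<close>

lemma newton_interpolation:
  fixes x :: "nat \<Rightarrow> 'a::field"
  assumes "inj x"
  shows "(\<Sum>n\<le>k. newton_coeff x f n * (\<Prod>i<n. x k - x i)) = f k"
proof -
  let ?D = "\<lambda>n j. \<Prod>i\<in>{..n} - {j}. x j - x i"
  have "(\<Sum>n\<le>k. newton_coeff x f n * (\<Prod>i<n. x k - x i)) =
      (\<Sum>n\<in>{..k}. \<Sum>j\<in>{j. j \<in> {..k} \<and> j \<le> n}. f j * ((\<Prod>i<n. x k - x i) / ?D n j))"
    unfolding newton_coeff_def sum_distrib_right
    by (intro sum.cong) auto
  also have "\<dots> = (\<Sum>j\<in>{..k}. \<Sum>n\<in>{n. n \<in> {..k} \<and> j \<le> n}. f j * ((\<Prod>i<n. x k - x i) / ?D n j))"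
    by (rule sum.swap_restrict) auto
  also have "\<dots> = (\<Sum>j\<in>{..k}. f j * (\<Sum>n=j..k. (\<Prod>i<n. x k - x i) / ?D n j))"
    unfolding sum_distrib_left by (intro sum.cong) auto
  also have "\<dots> = (\<Sum>j\<in>{..k}. f j * ((\<Prod>i\<in>{..k} - {j}. x k - x i) / ?D k j))"
    using newton_telescope[OF assms] by (intro sum.cong) auto
  \<comment> \<open>For \<open>j\<close> other than \<open>k\<close> the numerator contains the zero
    factor with \<open>i = k\<close>.\<close>
  also have "\<dots> = (\<Sum>j\<in>{k}. f j * ((\<Prod>i\<in>{..k} - {j}. x k - x i) / ?D k j))"
    by (rule sum.mono_neutral_right) auto
  also have "\<dots> = f k"
    using assms by (auto simp: inj_eq)
  finally show ?thesis .
qed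

text \<open>The linear system is triangular with nonzero diagonal entries
  \<open>\<Prod>i<k. x k - x i\<close>. The bound \<open>K\<close> lets agreement at finitely many
  nodes be exploited.\<close>

lemma newton_unique:
  fixes x :: "nat \<Rightarrow> 'a::field"
  assumes "inj x"
    and eq: "\<And>k. k < K \<Longrightarrow> (\<Sum>n\<le>k. c n * (\<Prod>i<n. x k - x i)) = (\<Sum>n\<le>k. d n * (\<Prod>i<n. x k - x i))"
    and "k < K"
  shows "c k = d k"
  using \<open>k < K\<close>
proof (induction k rule: less_induct)
  case (less k)
  have "(\<Prod>i<k. x k - x i) \<noteq> 0"
    using assms(1) by (auto simp: inj_eq)
  moreover have "(\<Sum>n<k. c n * (\<Prod>i<n. x k - x i)) = (\<Sum>n<k. d n * (\<Prod>i<n. x k - x i))"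
    using less by (intro sum.cong) auto
  ultimately show ?case
    using eq[OF less.prems] by (simp flip: lessThan_Suc_atMost)
qed

section \<open>Monic bases of a polynomial ring\<close>

lemma module_smult: "module (smult :: 'a::comm_ring_1 \<Rightarrow> 'a poly \<Rightarrow> 'a poly)"
  by unfold_locales (auto simp: smult_add_right smult_add_left)

lemma module_mult: "module ((*) :: 'a::comm_ring_1 \<Rightarrow> 'a \<Rightarrow> 'a)"
  by unfold_locales (auto simp: algebra_simps)

interpretation pm: module "smult :: 'a::comm_ring_1 \<Rightarrow> 'a poly \<Rightarrow> 'a poly"
  by (rule module_smult)

text \<open>Covers both \<open>e_basis\<close> and \<open>R_poly\<close>. Leading coefficient 1
  permits elimination of top terms without dividing by scalars.\<close>

locale monic_basis =
  fixes b :: "nat \<Rightarrow> 'a::comm_ring_1 poly"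
  assumes degree_b: "degree (b n) = n"
    and monic_b: "lead_coeff (b n) = 1"
begin

lemma inj_b: "inj b"
  by (metis degree_b injI)

lemma span_b: "pm.span (range b) = UNIV"
proof -
  have "p \<in> pm.span (range b)" if "degree p < n" for p n
    using that
  proof (induction n arbitrary: p)
    case (Suc n)
    let ?q = "p - smult (coeff p n) (b n)"
    have q: "?q \<in> pm.span (range b)"
    \<comment> \<open>Removing the top term lowers the degree, except for constants, where the
      remainder must itself be zero.\<close>
    proof (cases "n = 0 \<or> ?q = 0")
      case True
      then have "?q = 0"
      proof
        assume n: "n = 0"
        obtain a where a: "p = [:a:]" using Suc.prems n by (auto elim: degree_eq_zeroE)
        have "degree (b 0) = 0" by (rule degree_b)
        then obtain c where c: "b 0 = [:c:]" by (auto elim: degree_eq_zeroE)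
        then show ?thesis using n a monic_b[of 0] by simp
      qed
      then show ?thesis by (simp add: pm.span_zero)
    next
      case False
      have "degree ?q \<le> n"
        using Suc.prems by (intro degree_diff_le order.trans[OF degree_smult_le]) (auto simp: degree_b)
      moreover have "coeff ?q n = 0" using monic_b[of n] by (simp add: degree_b)
      ultimately have "degree ?q < n" using False
        by (metis leading_coeff_0_iff le_neq_implies_less)
      then show ?thesis by (rule Suc.IH)
    qed
    have "p = ?q + smult (coeff p n) (b n)" by simp
    then show ?case
      by (metis q pm.span_add pm.span_scale pm.span_base rangeI)
  qed simp
  then show ?thesis by blast
qed

text \<open>In a relation, let \<open>m\<close> be the largest index with a nonzero scalar. In
  degree \<open>m\<close> only \<open>b m\<close> contributes, so that scalar would be zero.\<close>

lemma independent_b: "\<not> pm.dependent (range b)"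
proof
  assume "pm.dependent (range b)"
  then obtain t u where t: "finite t" "t \<subseteq> range b" "(\<Sum>v\<in>t. smult (u v) v) = 0" "\<exists>v\<in>t. u v \<noteq> 0"
    unfolding pm.dependent_explicit by blast
  define S where "S = {n. b n \<in> t \<and> u (b n) \<noteq> 0}"
  have fin: "finite S"
    using finite_vimageI[OF t(1) inj_b] by (rule rev_finite_subset) (auto simp: S_def)
  have "S \<noteq> {}" using t by (auto simp: S_def)
  define m where "m = Max S"
  have m: "m \<in> S" "\<And>n. n \<in> S \<Longrightarrow> n \<le> m"
    using fin \<open>S \<noteq> {}\<close> by (auto simp: m_def)
  have zero: "u v * coeff v m = 0" if v: "v \<in> t" "v \<noteq> b m" for v
  proof -
    obtain n where n: "v = b n" using t(2) v(1) by blast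
    show ?thesis
    proof (cases "u v = 0")
      case False
      then have "n \<le> m" "n \<noteq> m" using m v n by (auto simp: S_def)
      then have "coeff v m = 0" unfolding n by (intro coeff_eq_0) (simp add: degree_b)
      then show ?thesis by simp
    qed simp
  qed
  have "0 = coeff (\<Sum>v\<in>t. smult (u v) v) m" using t by simp
  also have "\<dots> = (\<Sum>v\<in>t. u v * coeff v m)" by (simp add: coeff_sum)
  also have "\<dots> = (\<Sum>v\<in>{b m}. u v * coeff v m)"
    using t(1) m(1) zero by (intro sum.mono_neutral_right) (auto simp: S_def)
  also have "\<dots> = u (b m)" using monic_b[of m] by (simp add: degree_b)
  finally show False using m(1) by (simp add: S_def)
qed

abbreviation coord :: "'a poly \<Rightarrow> nat \<Rightarrow> 'a" where
  "coord f k \<equiv> pm.representation (range b) f (b k)"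

lemma finite_coord: "finite {k. coord f k \<noteq> 0}"
  using finite_vimageI[OF pm.finite_representation inj_b, of "range b" f] by (simp add: vimage_def)

lemma coord_expansion: "(\<Sum>k | coord f k \<noteq> 0. smult (coord f k) (b k)) = f"
proof -
  have "bij_betw b {k. coord f k \<noteq> 0} {v. pm.representation (range b) f v \<noteq> 0}"
    using inj_b pm.representation_ne_zero[of "range b" f]
    by (auto simp: bij_betw_def inj_on_def image_iff) blast
  then show ?thesis
    using pm.sum_nonzero_representation_eq[OF independent_b, of f] 
      sum.reindex_bij_betw[of b _ _ "\<lambda>v. smult (pm.representation (range b) f v) v"]
    by (simp add: span_b)
qed

text \<open>The target module is arbitrary, so that both the twist (values in \<open>skein\<close>)
  and the Hopf form (values in \<open>laurent\<close>) arise from it.\<close>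

lemma linear_extension:
  assumes "module s"
  shows "\<exists>t. module_hom smult s t \<and> (\<forall>i. t (b i) = v i)"
proof -
  interpret s: module s by fact
  define t where "t f = (\<Sum>k | coord f k \<noteq> 0. s (coord f k) (v k))" for f
  \<comment> \<open>Any finite index set containing the support computes \<open>t f\<close>, so
    several arguments can share one set.\<close>
  have t: "t f = (\<Sum>k\<in>K. s (coord f k) (v k))" if "finite K" "{k. coord f k \<noteq> 0} \<subseteq> K" for f K
    unfolding t_def using that by (intro sum.mono_neutral_left) auto
  have add: "coord (f + g) k = coord f k + coord g k" for f g k
    by (subst pm.representation_add[OF independent_b]) (auto simp: span_b)
  have scale: "coord (smult c f) k = c * coord f k" for f c k
    by (subst pm.representation_scale[OF independent_b]) (auto simp: span_b)
  have "module_hom smult s t"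
  proof unfold_locales
    fix f g
    let ?K = "{k. coord f k \<noteq> 0} \<union> {k. coord g k \<noteq> 0}"
    have "t f = (\<Sum>k\<in>?K. s (coord f k) (v k))" "t g = (\<Sum>k\<in>?K. s (coord g k) (v k))"
      "t (f + g) = (\<Sum>k\<in>?K. s (coord (f + g) k) (v k))"
      by (intro t; auto simp: add finite_coord)+
    then show "t (f + g) = t f + t g"
      by (simp add: add s.scale_left_distrib sum.distrib)
  next
    fix c f
    let ?K = "{k. coord f k \<noteq> 0}"
    have "t (smult c f) = (\<Sum>k\<in>?K. s (coord (smult c f) k) (v k))"
      by (intro t) (auto simp: scale finite_coord)
    then show "t (smult c f) = s c (t f)"
      by (simp add: scale s.scale_sum_right t_def)
  qed
  moreover have "t (b i) = v i" for i
  proof -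
    have "coord (b i) k = (if k = i then 1 else 0)" for k
      using inj_b by (subst pm.representation_basis[OF independent_b]) (auto simp: inj_eq)
    then have "t (b i) = (\<Sum>k\<in>{i}. s (coord (b i) k) (v k))" "coord (b i) i = 1"
      using t[of "{i}" "b i"] by auto
    then show ?thesis by simp
  qed
  ultimately show ?thesis by blast
qed

lemma hom_eqI:
  assumes "module_hom smult s f" "module_hom smult s g" "\<And>i. f (b i) = g (b i)"
  shows "f = g"
proof
  fix x
  interpret f: module_hom smult s f by fact
  interpret module_pair smult s by unfold_locales
  show "f x = g x"
    by (rule module_hom_eq_on_span[OF assms(1,2), of "range b"]) (auto simp: assms span_b)
qed

end


section \<open>Quantum integers\<close>

lemma a_pow_mult: "a_pow k * a_pow l = a_pow (k + l)"
  by (simp add: a_pow_def A_pow_def mult_single algebra_simps)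

lemma qbrace_0: "qbrace 0 = 0"
  by (simp add: qbrace_def)

lemma qbrace_neq_0: "n \<noteq> 0 \<Longrightarrow> qbrace n \<noteq> 0"
proof
  assume n: "n \<noteq> 0" "qbrace n = 0"
  \<comment> \<open>Since \<open>a = A^2\<close>, the two terms sit at the exponents
    \<open>2 * n\<close> and \<open>- 2 * n\<close>, which differ.\<close>
  have "Poly_Mapping.lookup (qbrace n) (2 * n) = 1"
    using n(1) by (simp add: qbrace_def a_pow_def A_pow_def lookup_minus lookup_single when_def)
  then show False using n by simp
qed

lemma qbrace_minus: "qbrace (- n) = - qbrace n"
  by (simp add: qbrace_def)

lemma to_fract_qbrace: "to_fract (qbrace n) = to_fract (qbrace 1) * qint n"
  using qbrace_neq_0[of 1] by (simp add: qint_def)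

lemma qint_neq_0: "n \<noteq> 0 \<Longrightarrow> qint n \<noteq> 0"
  using qbrace_neq_0 by (simp add: qint_def)

lemma qint_minus: "qint (- n) = - qint n"
  by (simp add: qint_def qbrace_minus)

lemma qfact_0: "qfact 0 = 1"
  by (simp add: qfact_def)

lemma qfact_Suc: "qfact (Suc n) = qint (int n + 1) * qfact n"
  by (simp add: qfact_def add.commute)

lemma qfact_neq_0: "qfact n \<noteq> 0"
  by (induction n) (auto simp: qfact_0 qfact_Suc intro!: qint_neq_0)

text \<open>Expanding \<open>{k}{l}\<close> gives a term in \<open>k + l\<close> minus one in
  \<open>k - l\<close>; for \<open>k = j - i\<close> and \<open>l = i + j + 1\<close> these are
  \<open>2 * j + 1\<close> and \<open>- (2 * i + 1)\<close>.\<close>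

lemma lam_diff: "lam (2 * j) - lam (2 * i) = - (qbrace (int j - int i) * qbrace (int i + int j + 1))"
proof -
  have mult: "qbrace k * qbrace l = a_pow (k + l) + a_pow (- (k + l)) - a_pow (k - l) - a_pow (- (k - l))" for k l
    by (simp add: qbrace_def algebra_simps a_pow_mult)
  have lam: "lam (2 * j) = - a_pow (2 * int j + 1) - a_pow (- (2 * int j + 1))" for j
    unfolding lam_def by (rule arg_cong2[where f = "\<lambda>x y. - a_pow x - a_pow y"]) auto
  have eq: "int j - int i + (int i + int j + 1) = 2 * int j + 1"
    "int j - int i - (int i + int j + 1) = - (2 * int i + 1)" by auto
  show ?thesis
    unfolding mult eq lam minus_minus
    by (simp only: diff_conv_add_uminus[of "_ :: laurent"] minus_add_distrib[of "_ :: laurent"] minus_minus add_ac[of "_ :: laurent"])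
qed

section \<open>Products of node differences\<close>

abbreviation node :: "nat \<Rightarrow> ratfun" where
  "node i \<equiv> to_fract (lam (2 * i))"

lemma node_diff:
  "node j - node i = - (to_fract (qbrace 1) ^ 2) * (qint (int j - int i) * qint (int i + int j + 1))"
  unfolding to_fract_diff[symmetric] lam_diff
  by (simp add: to_fract_qbrace[of "int j - int i"] to_fract_qbrace[of "int i + int j + 1"] power2_eq_square)

lemma inj_node: "inj node"
proof (rule injI, rule ccontr)
  fix i j assume "node i = node j" "i \<noteq> j"
  then show False
    using lam_diff[of i j] qbrace_neq_0[of "int i - int j"] qbrace_neq_0[of "int j + int i + 1"]
    by simp
qed

text \<open>The first factors multiply to \<open>[j]!/[j-m]!\<close>, the second to
  \<open>[j+m]!/[j]!\<close>. Keeping \<open>m\<close> apart from \<open>j\<close> makes the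
  induction possible.\<close>

lemma prod_qint_below:
  "m \<le> j \<Longrightarrow> (\<Prod>i<m. qint (int j - int i) * qint (int i + int j + 1)) * qfact (j - m) = qfact (j + m)"
proof (induction m)
  case (Suc m)
  have "j - m = Suc (j - Suc m)" using Suc.prems by simp
  then have "qfact (j - m) = qint (int j - int m) * qfact (j - Suc m)"
    using Suc.prems by (simp only: qfact_Suc) (simp add: of_nat_diff)
  moreover have "qfact (j + Suc m) = qint (int m + int j + 1) * qfact (j + m)"
    by (simp add: qfact_Suc add.commute)
  ultimately show ?case using Suc by (simp add: mult_ac)
qed simp

text \<open>The factors with \<open>i > j\<close> contain \<open>[-1], ..., [-(n-j)]\<close>, hence
  the sign and \<open>[n-j]!\<close>. Omitting \<open>i = j\<close> leaves a gap at
  \<open>[2j+1]\<close> in the other factors, hence the denominator.\<close>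

lemma prod_qint:
  assumes "j \<le> n"
  shows "(\<Prod>i\<in>{..n} - {j}. qint (int j - int i) * qint (int i + int j + 1)) =
    (- 1) ^ (n - j) * (qfact (n + j + 1) * qfact (n - j)) / qint (2 * int j + 1)"
  using assms
proof (induction n rule: dec_induct)
  case base
  have "{..j} - {j} = {..<j}" by auto
  then show ?case
    using prod_qint_below[of j j] qint_neq_0[of "2 * int j + 1"] qfact_Suc[of "j + j"]
    by (simp add: qfact_0)
next
  case (step n)
  have set: "{..Suc n} - {j} = insert (Suc n) ({..n} - {j})"
    using step.hyps by auto
  have diff: "qint (int j - int (Suc n)) = - qint (int (n - j) + 1)"
    using step.hyps unfolding qint_minus[symmetric] by (simp add: of_nat_diff algebra_simps)
  have fact: "qfact (Suc n + j + 1) = qint (int (Suc n) + int j + 1) * qfact (n + j + 1)"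
    "qfact (Suc n - j) = qint (int (n - j) + 1) * qfact (n - j)"
    "(- 1 :: ratfun) ^ (Suc n - j) = - ((- 1) ^ (n - j))"
    using step.hyps qfact_Suc[of "n + j + 1"] by (simp_all add: Suc_diff_le qfact_Suc add_ac)
  have "(\<Prod>i\<in>{..Suc n} - {j}. qint (int j - int i) * qint (int i + int j + 1)) =
      qint (int j - int (Suc n)) * qint (int (Suc n) + int j + 1) *
      (\<Prod>i\<in>{..n} - {j}. qint (int j - int i) * qint (int i + int j + 1))"
    unfolding set by (subst prod.insert) auto
  then show ?case
    unfolding step.IH diff fact by (simp only: mult_minus_left mult_minus_right times_divide_eq_right minus_divide_left mult_ac)
qed

lemma prod_node_diff:
  assumes "j \<le> n"
  shows "(\<Prod>i\<in>{..n} - {j}. node j - node i) =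
    (- 1) ^ j * to_fract (qbrace 1) ^ (2 * n) * (qfact (n + j + 1) * qfact (n - j)) / qint (2 * int j + 1)"
proof -
  have "card ({..n} - {j}) = n" using assms by simp
  \<comment> \<open>Each of the \<open>n\<close> factors carries a minus sign from
    \<open>node_diff\<close>; with the sign of \<open>prod_qint\<close> only \<open>(-1)^j\<close>
    is left.\<close>
  moreover have "(- 1) ^ n * (- 1) ^ (n - j) = ((- 1) ^ j :: ratfun)"
    using assms by (auto simp: le_iff_add power_add mult.assoc)
  ultimately show ?thesis
    unfolding node_diff prod.distrib[of "\<lambda>_. - (to_fract (qbrace 1) ^ 2)"] prod_qint[OF assms]
    by (simp add: power_mult power_minus[of "_ ^ 2"] mult.assoc mult.left_commute[of "(- 1) ^ (n - j)"])
qed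


section \<open>The skein module of the solid torus\<close>

lemma e_basis_Suc_Suc: "e_basis (Suc (Suc i)) = pCons 0 (e_basis (Suc i)) - e_basis i"
  by simp

interpretation e: monic_basis e_basis
proof -
  have *: "degree (e_basis n) \<le> n \<and> coeff (e_basis n) n = 1" for n
  proof (induction n rule: e_basis.induct)
    case (3 i)
    then have "degree (e_basis (Suc (Suc i))) \<le> Suc (Suc i)"
      unfolding e_basis_Suc_Suc by (intro degree_diff_le) (auto simp: degree_pCons_le intro: order.trans)
    moreover have "coeff (e_basis i) (Suc (Suc i)) = 0"
      using 3 by (intro coeff_eq_0) auto
    ultimately show ?case
      using 3 unfolding e_basis_Suc_Suc by simp
  qed auto
  then have deg: "degree (e_basis n) = n" for n
    by (intro antisym le_degree) auto
  show "monic_basis e_basis"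
    by unfold_locales (simp_all add: deg *)
qed

interpretation R: monic_basis R_poly
proof -
  have R_Suc: "R_poly (Suc n) = R_poly n * [:- lam (2 * n), 1:]" for n
    by (simp add: R_poly_def)
  have *: "degree (R_poly n) = n \<and> lead_coeff (R_poly n) = 1" for n
  proof (induction n)
    case (Suc n)
    then have "R_poly n \<noteq> 0" by auto
    then show ?case
      unfolding R_Suc lead_coeff_mult using Suc.IH by (subst degree_mult_eq) auto
  qed (simp add: R_poly_def)
  then show "monic_basis R_poly"
    by unfold_locales (use * in blast)+
qed

text \<open>Up to sign this is the three-term recursion of \<open>e_basis\<close>, which drives the
  induction for the next identity.\<close>

lemma lam_mult_qbrace: "lam i * qbrace l = - (qbrace (l + (int i + 1)) + qbrace (l - (int i + 1)))"
proof -
  have "(- a_pow m - a_pow (- m)) * qbrace l = - (qbrace (l + m) + qbrace (l - m))" for m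
    by (simp add: qbrace_def algebra_simps a_pow_mult)
  from this[of "int i + 1"] show ?thesis
    by (simp add: lam_def)
qed

text \<open>The Chebyshev identity \<open>S\<^sub>j (- x - 1/x) = (-1)\<^sup>j (x\<^sup>j\<^sup>+\<^sup>1 - x\<^sup>-\<^sup>j\<^sup>-\<^sup>1) / (x - 1/x)\<close>
  at \<open>x = a\<^sup>i\<^sup>+\<^sup>1\<close>, cleared of its denominator.\<close>

lemma poly_e_basis_lam:
  "poly (e_basis j) (lam i) * qbrace (int i + 1) = (- 1) ^ j * qbrace ((int i + 1) * (int j + 1))"
proof (induction j rule: e_basis.induct)
  case 2
  then show ?case
    using lam_mult_qbrace[of i "int i + 1"] by (simp add: qbrace_0 algebra_simps)
next
  case (3 j)
  have "poly (e_basis (Suc (Suc j))) (lam i) * qbrace (int i + 1) =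
      lam i * (poly (e_basis (Suc j)) (lam i) * qbrace (int i + 1)) - poly (e_basis j) (lam i) * qbrace (int i + 1)"
    by (simp add: algebra_simps)
  also have "\<dots> = (- 1) ^ Suc j * (lam i * qbrace ((int i + 1) * (int (Suc j) + 1)))
      - (- 1) ^ j * qbrace ((int i + 1) * (int j + 1))"
    unfolding 3 by (simp only: mult.left_commute)
  also have "\<dots> = (- 1) ^ j * qbrace ((int i + 1) * (int (Suc j) + 1) + (int i + 1))"
    unfolding lam_mult_qbrace by (simp add: algebra_simps)
  finally show ?case by (simp add: algebra_simps)
qed simp

text \<open>The Chebyshev identity at \<open>i = 0\<close>. It exhibits the quotient
  \<open>bracket_e i\<close> as a Laurent polynomial, so the Hopf form can take values in
  \<open>laurent\<close>.\<close>

lemma bracket_e_eq: "bracket_e i = to_fract (poly (e_basis i) (lam 0))"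
proof -
  have sign: "to_fract ((- 1) ^ i) = (- 1) ^ i"
    by (induction i) auto
  have "to_fract (poly (e_basis i) (lam 0) * qbrace 1) = to_fract ((- 1) ^ i * qbrace (int i + 1))"
    using poly_e_basis_lam[of i 0] by simp
  then have "to_fract (poly (e_basis i) (lam 0)) * to_fract (qbrace 1) = (- 1) ^ i * to_fract (qbrace (int i + 1))"
    unfolding to_fract_mult sign .
  then have "to_fract (poly (e_basis i) (lam 0)) = (- 1) ^ i * to_fract (qbrace (int i + 1)) / to_fract (qbrace 1)"
    using qbrace_neq_0[of 1] by (simp add: eq_divide_eq)
  then show ?thesis
    by (simp add: bracket_e_def qint_def)
qed

lemma poly_e_basis_lam_0_neq_0: "poly (e_basis i) (lam 0) \<noteq> 0"
  using poly_e_basis_lam[of i 0] qbrace_neq_0[of "int i + 1"] by auto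

text \<open>After multiplication by \<open>{1}\<close> both sides become
  \<open>(-1)^(i+j) {(i+1)(j+1)}\<close>, which is symmetric in \<open>i\<close> and
  \<open>j\<close>.\<close>

lemma hopf_symmetric_on_basis:
  "poly (e_basis j) (lam i) * poly (e_basis i) (lam 0) = poly (e_basis i) (lam j) * poly (e_basis j) (lam 0)"
proof -
  have "(poly (e_basis j) (lam i) * poly (e_basis i) (lam 0)) * qbrace 1 =
      (- 1) ^ i * (poly (e_basis j) (lam i) * qbrace (int i + 1))" for i j
    using poly_e_basis_lam[of i 0] by (simp add: mult.assoc mult.left_commute)
  then have "(poly (e_basis j) (lam i) * poly (e_basis i) (lam 0)) * qbrace 1 =
      (- 1) ^ (i + j) * qbrace ((int i + 1) * (int j + 1))" for i j
    unfolding poly_e_basis_lam by (simp add: power_add mult.assoc)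
  from this[where i = i and j = j] this[where i = j and j = i]
  have "(poly (e_basis j) (lam i) * poly (e_basis i) (lam 0)) * qbrace 1 =
      (poly (e_basis i) (lam j) * poly (e_basis j) (lam 0)) * qbrace 1"
    by (simp add: mult.commute add.commute)
  then show ?thesis using qbrace_neq_0[of 1] by simp
qed

section \<open>Existence and uniqueness of the Hopf form\<close>

abbreviation is_hopf_form :: "(skein \<Rightarrow> skein \<Rightarrow> laurent) \<Rightarrow> bool" where
  "is_hopf_form B \<equiv>
     (\<forall>f. module_hom smult (*) (B f)) \<and>
     (\<forall>g. module_hom smult (*) (\<lambda>f. B f g)) \<and>
     (\<forall>f g. B f g = B g f) \<and>
     (\<forall>f i. to_fract (B f (e_basis i)) = to_fract (poly f (lam i)) * bracket_e i)"

lemma is_hopf_form_basis: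
  "(\<forall>f i. to_fract (B f (e_basis i)) = to_fract (poly f (lam i)) * bracket_e i) \<longleftrightarrow>
    (\<forall>f i. B f (e_basis i) = poly f (lam i) * poly (e_basis i) (lam 0))"
  unfolding bracket_e_eq to_fract_mult[symmetric] to_fract_eq_iff ..

lemma ex1_hopf_form: "\<exists>!B. is_hopf_form B"
proof (rule ex_ex1I)
  have "\<exists>t. module_hom smult (*) t \<and> (\<forall>i. t (e_basis i) = poly f (lam i) * poly (e_basis i) (lam 0))" for f
    by (rule e.linear_extension[OF module_mult])
  then obtain B where hom: "\<And>f. module_hom smult (*) (B f)"
    and B: "\<And>f i. B f (e_basis i) = poly f (lam i) * poly (e_basis i) (lam 0)"
    by metis
  interpret B: module_hom smult "(*)" "B f" for f by (rule hom)
  interpret pair: module_pair "smult :: laurent \<Rightarrow> skein \<Rightarrow> skein" "(*) :: laurent \<Rightarrow> laurent \<Rightarrow> laurent"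
    by unfold_locales
  \<comment> \<open>Linearity in the first argument: both sides are homomorphisms in
    \<open>g\<close>, so comparing them on \<open>e_basis\<close> suffices.\<close>
  have add: "B (f + f') = (\<lambda>g. B f g + B f' g)" for f f'
    by (rule e.hom_eqI[OF hom pair.module_hom_add[OF hom hom]]) (simp add: B distrib_right)
  have scale: "B (smult c f) = (\<lambda>g. c * B f g)" for c f
  proof (rule e.hom_eqI)
    show "module_hom smult (*) (B (smult c f))" by (rule hom)
    show "module_hom smult (*) (\<lambda>g. c * B f g)" by (rule pair.module_hom_scale) (rule hom)
    show "B (smult c f) (e_basis i) = c * B f (e_basis i)" for i
      unfolding B poly_smult by (rule mult.assoc)
  qed
  have hom': "module_hom smult (*) (\<lambda>f. B f g)" for g
    by unfold_locales (auto simp: add scale)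
  \<comment> \<open>Symmetry on pairs of basis elements is extended to one argument first, then to
    the other.\<close>
  have "B (e_basis j) = (\<lambda>g. B g (e_basis j))" for j
    by (rule e.hom_eqI[OF hom hom']) (simp add: B hopf_symmetric_on_basis)
  then have "B (e_basis j) g = B g (e_basis j)" for j g
    by metis
  then have "(\<lambda>f. B f g) = B g" for g
    by (intro e.hom_eqI[OF hom' hom])
  then have "B f g = B g f" for f g
    by metis
  then show "\<exists>B. is_hopf_form B"
    unfolding is_hopf_form_basis using hom hom' B by blast
next
  fix B B' assume "is_hopf_form B" "is_hopf_form B'"
  then have "B f = B' f" for f
    unfolding is_hopf_form_basis by (intro e.hom_eqI[where s = "(*)"]) auto
  then show "B = B'" by blast
qed

lemma is_hopf_form_hopf_form: "is_hopf_form hopf_form"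
  unfolding hopf_form_def by (rule theI'[OF ex1_hopf_form])

lemma hopf_form_e_basis: "hopf_form f (e_basis i) = poly f (lam i) * poly (e_basis i) (lam 0)"
  using is_hopf_form_hopf_form unfolding is_hopf_form_basis by blast

lemma module_hom_hopf_form: "module_hom smult (*) (hopf_form f)"
  using is_hopf_form_hopf_form by blast

lemma skein_bracket_eq: "skein_bracket x = poly x (lam 0)"
  using hopf_form_e_basis[of x 0] by (simp add: skein_bracket_def)

section \<open>The twist map and the even submodule\<close>

lemma
  shows module_hom_twist: "module_hom smult smult twist"
    and twist_e_basis: "twist (e_basis i) = smult (twist_eigenvalue i) (e_basis i)"
proof -
  let ?P = "\<lambda>t. module_hom smult smult t \<and> (\<forall>i. t (e_basis i) = smult (twist_eigenvalue i) (e_basis i))"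
  have "\<exists>!t. ?P t"
  proof (rule ex_ex1I)
    show "\<exists>t. ?P t"
      by (rule e.linear_extension[OF module_smult])
    show "t = t'" if "?P t" "?P t'" for t t'
      using that by (intro e.hom_eqI[where s = smult]) auto
  qed
  from theI'[OF this] have "?P twist" unfolding twist_def .
  then show "module_hom smult smult twist" "twist (e_basis i) = smult (twist_eigenvalue i) (e_basis i)"
    by auto
qed

text \<open>Two applications of \<open>z * e_(i+1) = e_(i+2) + e_i\<close>. Thus multiplication by
  \<open>z^2\<close> preserves even indices.\<close>

lemma e_basis_even_Suc: "[:0, 0, 1:] * e_basis (2 * Suc k) =
    e_basis (2 * Suc (Suc k)) + smult 2 (e_basis (2 * Suc k)) + e_basis (2 * k)"
proof -
  have step: "pCons 0 (e_basis (Suc i)) = e_basis (Suc (Suc i)) + e_basis i" for i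
    by simp
  have double: "smult 2 p = p + p" for p :: skein
    using smult_add_left[of 1 1 p] by simp
  have "[:0, 0, 1:] * e_basis (2 * Suc k) = pCons 0 (pCons 0 (e_basis (Suc (Suc (2 * k)))))"
    by simp
  also have "\<dots> = pCons 0 (e_basis (Suc (Suc (Suc (2 * k))))) + pCons 0 (e_basis (Suc (2 * k)))"
    unfolding step[of "Suc (2 * k)"] by simp
  also have "\<dots> = e_basis (2 * Suc (Suc k)) + smult 2 (e_basis (2 * Suc k)) + e_basis (2 * k)"
    unfolding step[of "Suc (Suc (2 * k))"] step[of "2 * k"]
    by (simp del: e_basis.simps add: double)
  finally show ?thesis .
qed


text \<open>The twist and the Hopf form are known on \<open>e_basis\<close>, so the even part needs
  generators of that kind. Both spans are closed under multiplication by \<open>z^2\<close>, which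
  reaches every generator of the other.\<close>

lemma skein_even_eq: "skein_even = pm.span (range (\<lambda>k. e_basis (2 * k)))"
proof -
  let ?Z = "pm.span (range (\<lambda>k. [:0, 1:] ^ (2 * k)) :: skein set)"
  let ?E = "pm.span (range (\<lambda>k. e_basis (2 * k)))"
  have E: "e_basis (2 * k) \<in> ?E" for k
    by (rule pm.span_base) simp
  have square: "[:0, 1:] ^ (2 * Suc k) = [:0, 0, 1:] * ([:0, 1:] ^ (2 * k) :: skein)" for k
    by simp
  have Z_mult: "[:0, 0, 1:] * x \<in> ?Z" if "x \<in> ?Z" for x
    using that
  proof (induction rule: pm.span_induct_alt)
    case (step c x y)
    then obtain k where k: "x = [:0, 1:] ^ (2 * k)" by auto
    have mem: "[:0, 0, 1:] * x \<in> ?Z"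
      unfolding k square[symmetric] by (rule pm.span_base) (rule rangeI)
    show ?case
      unfolding distrib_left mult_smult_right by (rule pm.span_add[OF pm.span_scale[OF mem] step.IH])
  qed (simp add: pm.span_zero)
  have E_mult: "[:0, 0, 1:] * x \<in> ?E" if "x \<in> ?E" for x
    using that
  proof (induction rule: pm.span_induct_alt)
    case (step c x y)
    then obtain k where k: "x = e_basis (2 * k)" by auto
    have mem: "[:0, 0, 1:] * x \<in> ?E"
    proof (cases k)
      case 0
      \<comment> \<open>The recursion of \<open>e_basis_even_Suc\<close> begins only at
        \<open>e_basis 2\<close>.\<close>
      have "[:0, 0, 1:] * e_basis (2 * 0) = e_basis (2 * 1) + e_basis (2 * 0)"
        by (simp add: numeral_2_eq_2)
      then show ?thesis unfolding k 0 by (metis E pm.span_add)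
    next
      case (Suc k)
      show ?thesis
        unfolding \<open>x = _\<close> Suc e_basis_even_Suc by (intro pm.span_add pm.span_scale E)
    qed
    show ?case
      unfolding distrib_left mult_smult_right by (rule pm.span_add[OF pm.span_scale[OF mem] step.IH])
  qed (simp add: pm.span_zero)
  have "[:0, 1:] ^ (2 * k) \<in> ?E" for k
  proof (induction k)
    case 0
    show ?case using E[of 0] by simp
  next
    case (Suc k)
    then show ?case unfolding square by (rule E_mult)
  qed
  \<comment> \<open>Two neighbouring even indices are carried along because the recursion reaches
    back two steps.\<close>
  moreover have "e_basis (2 * k) \<in> ?Z \<and> e_basis (2 * Suc k) \<in> ?Z" for k
  proof (induction k)
    case 0
    have one: "(1 :: skein) \<in> ?Z" by (rule pm.span_base) (auto intro: range_eqI[of _ _ 0])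
    have "e_basis (2 * Suc 0) = [:0, 0, 1:] * 1 - 1"
      by (simp add: numeral_2_eq_2)
    also have "\<dots> \<in> ?Z" using one by (intro pm.span_diff Z_mult)
    finally show ?case using one by simp
  next
    case (Suc k)
    have "e_basis (2 * Suc (Suc k)) =
        [:0, 0, 1:] * e_basis (2 * Suc k) - smult 2 (e_basis (2 * Suc k)) - e_basis (2 * k)"
      unfolding e_basis_even_Suc by (simp del: e_basis.simps)
    also have "\<dots> \<in> ?Z"
      using Suc by (intro pm.span_diff pm.span_scale Z_mult) auto
    finally show ?case using Suc by blast
  qed
  ultimately show ?thesis
    unfolding skein_even_def by (subst pm.span_eq) auto
qed

section \<open>Series as functions on the nodes\<close>

abbreviation newton_poly :: "nat \<Rightarrow> nat \<Rightarrow> ratfun" where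
  "newton_poly n k \<equiv> \<Prod>i<n. node k - node i"

text \<open>The value of a series at \<open>z = \<lambda>\<^sub>2\<^sub>k\<close>, where \<open>R\<^sub>n\<close> vanishes for \<open>n > k\<close>.\<close>

definition series_eval :: "R_series \<Rightarrow> nat \<Rightarrow> ratfun" where
  "series_eval c k = (\<Sum>n\<le>k. c n * newton_poly n k)"

lemma to_fract_poly_R_poly: "to_fract (poly (R_poly n) (lam (2 * k))) = newton_poly n k"
  by (induction n) (simp_all add: R_poly_def right_diff_distrib mult.commute[of _ "newton_poly _ k"])

lemma to_fract_sum: "to_fract (sum f A) = (\<Sum>x\<in>A. to_fract (f x))"
  by (induction A rule: infinite_finite_induct) auto

lemma newton_poly_eq_0: "k < n \<Longrightarrow> newton_poly n k = 0"
  by auto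

text \<open>Triangularity makes evaluation injective; the next lemma makes it surjective onto
  functions on the nodes.\<close>

lemma series_eq_iff: "c = d \<longleftrightarrow> (\<forall>k. series_eval c k = series_eval d k)"
proof
  assume eq: "\<forall>k. series_eval c k = series_eval d k"
  have "c k = d k" for k
    using newton_unique[OF inj_node, of "Suc k" c d k] eq by (simp add: series_eval_def)
  then show "c = d" by blast
qed simp

lemma series_eval_newton_coeff: "series_eval (newton_coeff node f) k = f k"
  using newton_interpolation[OF inj_node] by (simp add: series_eval_def)

text \<open>The expansion of \<open>R_n R_m\<close> evaluated at \<open>z = \<lambda>_2k\<close>.
  Terms with \<open>l > k\<close> vanish there, so the sum may stop at \<open>k\<close>.\<close>

lemma R_structure_const_expansion:
  "(\<Sum>l\<le>k. to_fract (R_structure_const n m l) * newton_poly l k) = newton_poly n k * newton_poly m k"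
proof -
  let ?C = "R_structure_const n m"
  let ?S = "{l. ?C l \<noteq> 0}"
  have fin: "finite ?S"
    using R.finite_coord[of "R_poly n * R_poly m"] by (simp add: R_structure_const_def)
  have expansion: "R_poly n * R_poly m = (\<Sum>l\<in>?S. smult (?C l) (R_poly l))"
    using R.coord_expansion[of "R_poly n * R_poly m"] by (simp add: R_structure_const_def)
  have poly: "poly (R_poly n * R_poly m) (lam (2 * k)) = (\<Sum>l\<in>?S. ?C l * poly (R_poly l) (lam (2 * k)))"
    unfolding expansion poly_sum poly_smult ..
  have "newton_poly n k * newton_poly m k = to_fract (poly (R_poly n * R_poly m) (lam (2 * k)))"
    unfolding poly_mult to_fract_mult to_fract_poly_R_poly ..
  also have "\<dots> = (\<Sum>l\<in>?S. to_fract (?C l) * newton_poly l k)"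
    unfolding poly to_fract_sum to_fract_mult to_fract_poly_R_poly ..
  also have "\<dots> = (\<Sum>l\<in>?S \<union> {..k}. to_fract (?C l) * newton_poly l k)"
    using fin by (intro sum.mono_neutral_left) auto
  also have "\<dots> = (\<Sum>l\<le>k. to_fract (?C l) * newton_poly l k)"
    using fin newton_poly_eq_0 by (intro sum.mono_neutral_right) auto
  finally show ?thesis by simp
qed

text \<open>The product \<open>R_n R_m\<close> vanishes at the first \<open>max n m\<close> nodes,
  so uniqueness of Newton coefficients kills all coefficients below that index.\<close>

lemma R_structure_const_eq_0:
  assumes "k < n \<or> k < m"
  shows "R_structure_const n m k = 0"
proof -
  have "to_fract (R_structure_const n m k) = 0"
  proof (rule newton_unique[OF inj_node, where d = "\<lambda>_. 0" and K = "max n m"])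
    fix l assume "l < max n m"
    then have "newton_poly n l * newton_poly m l = 0"
      using newton_poly_eq_0[of l n] newton_poly_eq_0[of l m]
      by (auto simp only: less_max_iff_disj mult_zero_left mult_zero_right)
    then show "(\<Sum>j\<le>l. to_fract (R_structure_const n m j) * newton_poly j l) = (\<Sum>j\<le>l. 0 * newton_poly j l)"
      unfolding R_structure_const_expansion by simp
  qed (use assms in auto)
  then show ?thesis by simp
qed

lemma series_eval_mult:
  "series_eval (c \<otimes>\<^bsub>series_ring\<^esub> d) k = series_eval c k * series_eval d k"
proof -
  let ?C = "\<lambda>n m l. to_fract (R_structure_const n m l)"
  \<comment> \<open>The range for \<open>n\<close> and \<open>m\<close> depends on \<open>l\<close>;
    enlarging it up to \<open>k\<close> adds only vanishing structure constants and lets the sums be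
    swapped.\<close>
  have inner: "(\<Sum>n\<le>l. \<Sum>m\<le>l. c n * d m * ?C n m l) = (\<Sum>n\<le>k. \<Sum>m\<le>k. c n * d m * ?C n m l)" if "l \<le> k" for l
    using that
    by (intro sum.mono_neutral_cong_left sum.mono_neutral_left ballI)
       (auto simp: R_structure_const_eq_0 not_le)
  have "series_eval (c \<otimes>\<^bsub>series_ring\<^esub> d) k =
      (\<Sum>l\<le>k. \<Sum>n\<le>k. \<Sum>m\<le>k. c n * d m * ?C n m l * newton_poly l k)"
    unfolding series_eval_def by (intro sum.cong) (auto simp: series_ring_def inner sum_distrib_right)
  also have "\<dots> = (\<Sum>n\<le>k. \<Sum>m\<le>k. \<Sum>l\<le>k. c n * d m * ?C n m l * newton_poly l k)"
    by (subst sum.swap) (intro sum.cong refl sum.swap)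
  also have "\<dots> = (\<Sum>n\<le>k. \<Sum>m\<le>k. c n * d m * (newton_poly n k * newton_poly m k))"
    by (simp only: mult.assoc sum_distrib_left[symmetric] R_structure_const_expansion)
  also have "\<dots> = series_eval c k * series_eval d k"
    unfolding series_eval_def sum_product by (intro sum.cong refl) (simp add: mult_ac)
  finally show ?thesis .
qed

lemma series_eval_one: "series_eval \<one>\<^bsub>series_ring\<^esub> k = 1"
proof -
  have "series_eval \<one>\<^bsub>series_ring\<^esub> k = (\<Sum>n\<in>{0}. newton_poly n k)"
    unfolding series_eval_def by (rule sum.mono_neutral_cong_right) (auto simp: series_ring_def)
  then show ?thesis by simp
qed

lemma series_eval_nat_pow: "series_eval (c [^]\<^bsub>series_ring\<^esub> (n :: nat)) k = series_eval c k ^ n"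
  by (induction n) (simp_all add: series_eval_one series_eval_mult)

text \<open>Inverting the values and interpolating gives an inverse; injectivity of evaluation makes
  it the only candidate in the definite description behind \<open>inv\<close>.\<close>

lemma series_eval_inv:
  assumes "\<And>k. series_eval c k \<noteq> 0"
  shows "series_eval (inv\<^bsub>series_ring\<^esub> c) k = inverse (series_eval c k)"
proof -
  define d where "d = newton_coeff node (\<lambda>k. inverse (series_eval c k))"
  have d: "series_eval d k = inverse (series_eval c k)" for k
    by (simp add: d_def series_eval_newton_coeff)
  have inverse_iff: "u * v = 1 \<longleftrightarrow> v = inverse u" if "u \<noteq> 0" for u v :: ratfun
    using that by (metis inverse_unique right_inverse)
  have iff: "c \<otimes>\<^bsub>series_ring\<^esub> y = \<one>\<^bsub>series_ring\<^esub> \<longleftrightarrow> y = d" for y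
    unfolding series_eq_iff[of "c \<otimes>\<^bsub>series_ring\<^esub> y"] series_eq_iff[of y]
    by (simp only: series_eval_mult series_eval_one d inverse_iff[OF assms])
  have "d \<otimes>\<^bsub>series_ring\<^esub> c = \<one>\<^bsub>series_ring\<^esub>"
    by (subst series_eq_iff) (simp only: series_eval_mult series_eval_one d left_inverse[OF assms] simp_thms)
  then have "inv\<^bsub>series_ring\<^esub> c = d"
    unfolding m_inv_def iff by (intro the_equality) (auto simp: series_ring_def)
  then show ?thesis using d by simp
qed

lemma series_eval_int_pow:
  assumes "\<And>k. series_eval c k \<noteq> 0"
  shows "series_eval (c [^]\<^bsub>series_ring\<^esub> (p :: int)) k = series_eval c k powi p"
proof (cases "p < 0")
  case True
  then have neg: "\<not> 0 \<le> p" by simp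
  have nz: "series_eval (c [^]\<^bsub>series_ring\<^esub> nat (- p)) k \<noteq> 0" for k
    unfolding series_eval_nat_pow using assms by (rule power_not_zero)
  show ?thesis
    unfolding int_pow_def2 power_int_def if_P[OF True] if_not_P[OF neg] series_eval_inv[OF nz]
    by (simp only: series_eval_nat_pow power_inverse)
next
  case False
  then obtain m where "p = int m"
    by (metis nonneg_int_cases not_less)
  then show ?thesis
    by (simp add: int_pow_int series_eval_nat_pow)
qed

section \<open>The twist series\<close>

lemma hopf_form_R_poly:
  "to_fract (hopf_form (R_poly n) (e_basis (2 * k))) = newton_poly n k * to_fract (poly (e_basis (2 * k)) (lam 0))"
  by (simp add: hopf_form_e_basis to_fract_poly_R_poly)

lemma hopf_form_R_poly_eq_0: "k < n \<Longrightarrow> hopf_form (R_poly n) (e_basis (2 * k)) = 0"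
  using hopf_form_R_poly[of n k] newton_poly_eq_0[of k n] by simp

text \<open>\<open>Sum_any\<close> is 0 on an infinite support, so a cutoff \<open>N\<close> has to
  be exhibited before the pairing can be computed.\<close>

lemma series_pairing_sum:
  assumes "\<And>n. n \<ge> N \<Longrightarrow> hopf_form (R_poly n) x = 0"
  shows "series_pairing c x = (\<Sum>n<N. c n * to_fract (hopf_form (R_poly n) x))"
  unfolding series_pairing_def
proof (rule Sum_any.expand_superset)
  show "{n. c n * to_fract (hopf_form (R_poly n) x) \<noteq> 0} \<subseteq> {..<N}"
  proof
    fix n assume "n \<in> {n. c n * to_fract (hopf_form (R_poly n) x) \<noteq> 0}"
    then have "\<not> n \<ge> N" using assms[of n] by auto
    then show "n \<in> {..<N}" by simp
  qed
qed simp

lemma series_pairing_e_basis: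
  "series_pairing c (e_basis (2 * k)) = series_eval c k * to_fract (poly (e_basis (2 * k)) (lam 0))"
proof -
  have "series_pairing c (e_basis (2 * k)) = (\<Sum>n<Suc k. c n * to_fract (hopf_form (R_poly n) (e_basis (2 * k))))"
    by (rule series_pairing_sum) (simp add: hopf_form_R_poly_eq_0)
  then show ?thesis
    unfolding hopf_form_R_poly lessThan_Suc_atMost by (simp add: series_eval_def sum_distrib_right mult.assoc)
qed

lemma skein_bracket_twist_e_basis:
  "skein_bracket (twist (e_basis i)) = twist_eigenvalue i * poly (e_basis i) (lam 0)"
  by (simp add: skein_bracket_eq twist_e_basis)

text \<open>On \<open>e_basis (2 * k)\<close> both sides carry the nonzero factor
  \<open>\<langle>e_2k\<rangle>\<close>, and cancelling it leaves the values at the nodes. The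
  converse extends by linearity.\<close>

lemma twist_series_iff:
  "(\<forall>x\<in>skein_even. series_pairing c x = to_fract (skein_bracket (twist x))) \<longleftrightarrow>
    (\<forall>k. series_eval c k = to_fract (twist_eigenvalue (2 * k)))"
proof
  assume *: "\<forall>x\<in>skein_even. series_pairing c x = to_fract (skein_bracket (twist x))"
  show "\<forall>k. series_eval c k = to_fract (twist_eigenvalue (2 * k))"
  proof
    fix k
    have "e_basis (2 * k) \<in> skein_even"
      unfolding skein_even_eq by (rule pm.span_base) simp
    then have "series_eval c k * to_fract (poly (e_basis (2 * k)) (lam 0)) =
        to_fract (twist_eigenvalue (2 * k)) * to_fract (poly (e_basis (2 * k)) (lam 0))"
      using * by (metis series_pairing_e_basis skein_bracket_twist_e_basis to_fract_mult)
    then show "series_eval c k = to_fract (twist_eigenvalue (2 * k))"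
      using poly_e_basis_lam_0_neq_0 by simp
  qed
next
  assume eval: "\<forall>k. series_eval c k = to_fract (twist_eigenvalue (2 * k))"
  interpret twist: module_hom smult smult twist by (rule module_hom_twist)
  interpret hopf: module_hom smult "(*)" "hopf_form f" for f by (rule module_hom_hopf_form)
  \<comment> \<open>The cutoff is part of the induction claim because linearity of the pairing is
    derived from finite sums.\<close>
  have "(\<exists>N. \<forall>n\<ge>N. hopf_form (R_poly n) x = 0) \<and> series_pairing c x = to_fract (skein_bracket (twist x))"
    if "x \<in> pm.span (range (\<lambda>k. e_basis (2 * k)))" for x
    using that
  proof (induction rule: pm.span_induct_alt)
    case base
    then show ?case by (simp add: skein_bracket_eq series_pairing_def)
  next
    case (step a x y)
    then obtain k N where k: "x = e_basis (2 * k)"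
      and N: "\<And>n. n \<ge> N \<Longrightarrow> hopf_form (R_poly n) y = 0"
      and y: "series_pairing c y = to_fract (skein_bracket (twist y))"
      by blast
    define M where "M = max N (Suc k)"
    have 0: "hopf_form (R_poly n) x = 0" "hopf_form (R_poly n) y = 0" if "n \<ge> M" for n
      using that N unfolding k M_def by (simp_all add: hopf_form_R_poly_eq_0)
    have x: "series_pairing c x = to_fract (skein_bracket (twist x))"
      unfolding k series_pairing_e_basis skein_bracket_twist_e_basis using eval by simp
    have "series_pairing c (smult a x + y) = to_fract a * series_pairing c x + series_pairing c y"
      by (subst (1 2 3) series_pairing_sum[of M])
         (simp_all add: 0 hopf.add hopf.scale sum.distrib sum_distrib_left algebra_simps)
    also have "\<dots> = to_fract (skein_bracket (twist (smult a x + y)))"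
      unfolding x y by (simp add: skein_bracket_eq twist.add twist.scale)
    finally show ?case
      using 0 by (auto simp: hopf.add hopf.scale intro!: exI[of _ M])
  qed
  then show "\<forall>x\<in>skein_even. series_pairing c x = to_fract (skein_bracket (twist x))"
    unfolding skein_even_eq by blast
qed

text \<open>Interpolating the twist eigenvalues supplies the witness that makes the definite
  description of \<open>omega\<close> meaningful.\<close>

lemma series_eval_omega: "series_eval omega k = to_fract (twist_eigenvalue (2 * k))"
proof -
  have "\<exists>!c. \<forall>k. series_eval c k = to_fract (twist_eigenvalue (2 * k))"
    by (rule ex1I[of _ "newton_coeff node (\<lambda>k. to_fract (twist_eigenvalue (2 * k)))"])
       (simp_all add: series_eq_iff series_eval_newton_coeff)
  from theI'[OF this] show ?thesis
    unfolding omega_def twist_series_iff by blast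
qed

lemma twist_eigenvalue_neq_0: "twist_eigenvalue i \<noteq> 0"
proof -
  have "A_pow k \<noteq> 0" for k
    by (metis A_pow_def lookup_single_eq lookup_zero zero_neq_one)
  then show ?thesis by (simp add: twist_eigenvalue_def)
qed

theorem theorem3p2:
  fixes p :: int and n :: nat
  shows "(omega [^]\<^bsub>series_ring\<^esub> p) n =
    1 / (to_fract (a_pow 1) - to_fract (a_pow (- 1))) ^ (2 * n) *
    (\<Sum>k=0..n. (- 1) ^ k * to_fract (twist_eigenvalue (2 * k)) powi p * qint (2 * int k + 1) /
      (qfact (n + k + 1) * qfact (n - k)))"
proof -
  let ?mu = "\<lambda>k. to_fract (twist_eigenvalue (2 * k)) powi p"
  \<comment> \<open>Both series take the value \<open>\<mu>_2k^p\<close> at every node; nonzero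
    eigenvalues make this valid for negative \<open>p\<close> too.\<close>
  have "omega [^]\<^bsub>series_ring\<^esub> p = newton_coeff node ?mu"
    by (subst series_eq_iff)
       (simp add: series_eval_newton_coeff series_eval_int_pow series_eval_omega twist_eigenvalue_neq_0)
  moreover have "?mu k / (\<Prod>i\<in>{..n} - {k}. node k - node i) = 1 / to_fract (qbrace 1) ^ (2 * n) *
      ((- 1) ^ k * ?mu k * qint (2 * int k + 1) / (qfact (n + k + 1) * qfact (n - k)))" if "k \<le> n" for k
  proof -
    \<comment> \<open>The sign stands in the denominator; being its own inverse, it moves to the
      numerator.\<close>
    have "(- 1) ^ k * (- 1) ^ k = (1 :: ratfun)" by simp
    then show ?thesis
      unfolding prod_node_diff[OF that]
      using qbrace_neq_0[of 1] qfact_neq_0 qint_neq_0[of "2 * int k + 1"]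
      by (simp add: divide_simps mult_ac)
  qed
  ultimately show ?thesis
    by (simp add: newton_coeff_def qbrace_def atLeast0AtMost sum_distrib_left)
qed

end
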